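(* Let $N\ge 1$ be an integer, let $\delta>0$, and put $$\gamma=\frac{2^{N-2}}{N\cdot (N!)^2},\qquad T^*=\frac{1}{\gamma\delta}.$$ Let $\varepsilon_j\in(0,\tfrac12)$ for $1\le j\le N$, and define $M_j^*=\frac{1}{\gamma\varepsilon_j}$ (so $M_j^*\ge 1$), $1\le j\le N$. Suppose the real numbers $\lambda_1,\dots,\lambda_N$ satisfy $$\min_{\substack{(m_1,\dots,m_N)\in\mathbb{Z}^N\setminus\{(0,\dots,0)\}:\\ |m_j|\le M_j^*,\ 1\le j\le N}} |m_1\lambda_1+\dots+m_N\lambda_N|\ \ge\ \delta .$$ Then for any real numbers $\alpha_1,\dots,\alpha_N$ and any $\tau\in\mathbb{R}$ there exists a real number $t\in[\tau,\tau+T^*]$ such that $$\|\lambda_j t-\alpha_j\|\le\varepsilon_j\quad\text{for all } 1\le j\le N.$$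
   Context: For a real number $\xi$, $\|\xi\|$ denotes the distance from $\xi$ to the nearest integer. *)

theory Defs
  imports Complex_Main "HOL-Library.FuncSet"
begin

definition dist_nearest_int :: "real \<Rightarrow> real" where
  "dist_nearest_int \<xi> = \<bar>\<xi> - of_int (round \<xi>)\<bar>"

lemma dist_nearest_int_le: "dist_nearest_int \<xi> \<le> \<bar>\<xi> - of_int n\<bar>"
  unfolding dist_nearest_int_def
  using round_diff_minimal[of \<xi> n] by simp

definition kron_gamma :: "nat \<Rightarrow> real" where
  "kron_gamma N = 2 powi (int N - 2) / (real N * (fact N)\<^sup>2)"

text \<open>Integer vectors indexed by \<open>{1..N}\<close> are represented by extensional functions, so that
  the following set is finite and minima over it are meaningful.\<close>

definition coeff_vectors :: "nat \<Rightarrow> (nat \<Rightarrow> real) \<Rightarrow> (nat \<Rightarrow> int) set" where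
  "coeff_vectors N M =
     {m \<in> {1..N} \<rightarrow>\<^sub>E UNIV. (\<exists>j\<in>{1..N}. m j \<noteq> 0) \<and> (\<forall>j\<in>{1..N}. \<bar>real_of_int (m j)\<bar> \<le> M j)}"

lemma finite_coeff_vectors: "finite (coeff_vectors N M)"
proof (rule finite_subset)
  show "coeff_vectors N M \<subseteq> (\<Pi>\<^sub>E j\<in>{1..N}. {- \<lfloor>M j\<rfloor>..\<lfloor>M j\<rfloor>})"
  proof
    fix m assume m: "m \<in> coeff_vectors N M"
    have "m j \<in> {- \<lfloor>M j\<rfloor>..\<lfloor>M j\<rfloor>}" if "j \<in> {1..N}" for j
    proof -
      have "real_of_int \<bar>m j\<bar> \<le> M j"
        using m that by (auto simp: coeff_vectors_def)
      then have "\<bar>m j\<bar> \<le> \<lfloor>M j\<rfloor>"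
        by (simp only: le_floor_iff)
      then show ?thesis by auto
    qed
    moreover have "m \<in> extensional {1..N}"
      using m by (auto simp: coeff_vectors_def PiE_def)
    ultimately show "m \<in> (\<Pi>\<^sub>E j\<in>{1..N}. {- \<lfloor>M j\<rfloor>..\<lfloor>M j\<rfloor>})"
      by (simp add: PiE_def)
  qed
  show "finite (\<Pi>\<^sub>E j\<in>{1..N}. {- \<lfloor>M j\<rfloor>..\<lfloor>M j\<rfloor>})"
    by (intro finite_PiE) auto
qed

lemma coeff_vectors_nonempty:
  assumes "N \<ge> 1" "\<And>j. j \<in> {1..N} \<Longrightarrow> M j \<ge> 1"
  shows "coeff_vectors N M \<noteq> {}"
proof -
  have "(\<lambda>j\<in>{1..N}. 1) \<in> coeff_vectors N M"
    using assms by (auto simp: coeff_vectors_def)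
  then show ?thesis by blast
qed

end

theory Submission
  imports Defs
begin

text \<open>Send an integer vector \<open>m\<close> to \<open>V m = (T/2 * (\<Sum>j. m j * lam j), \<epsilon> 1 * m 1, \<dots>, \<epsilon> N * m N)\<close>.
  The hypothesis says that every nonzero vector of this lattice has length at least \<open>1 / (2\<gamma>)\<close>.
  A vector \<open>s\<close> whose inner products with the lattice agree modulo 1 with the prescribed additive
  function determined by \<open>\<alpha>\<close> and \<open>\<tau>\<close> yields \<open>t = \<tau> + T/2 + (T/2) * s 0\<close>, with errors \<open>\<epsilon> j * s j\<close>;
  so it suffices to find such an \<open>s\<close> of length at most 1. It is built by successively
  projecting the lattice along nearly shortest vectors and correcting \<open>s\<close> in each of these
  orthogonal directions by at most half the reciprocal of the length of the vector.\<close>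

section \<open>Inner products and orthonormal families\<close>

definition dot :: "'i set \<Rightarrow> ('i \<Rightarrow> real) \<Rightarrow> ('i \<Rightarrow> real) \<Rightarrow> real" where
  "dot I x y = (\<Sum>i\<in>I. x i * y i)"

lemma dot_commute: "dot I x y = dot I y x"
  by (simp add: dot_def mult.commute)

lemma dot_add_scale_right: "dot I x (\<lambda>i. y i + a * z i) = dot I x y + a * dot I x z"
  by (simp add: dot_def sum.distrib sum_distrib_left algebra_simps)

lemma dot_diff_scale_right: "dot I x (\<lambda>i. y i - a * z i) = dot I x y - a * dot I x z"
  by (simp add: dot_def sum_subtractf sum_distrib_left algebra_simps)

lemma dot_add_scale_left: "dot I (\<lambda>i. y i + a * z i) x = dot I y x + a * dot I z x"
  by (metis dot_add_scale_right dot_commute)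

lemma dot_diff_scale_left: "dot I (\<lambda>i. y i - a * z i) x = dot I y x - a * dot I z x"
  by (metis dot_diff_scale_right dot_commute)

lemma dot_scale_left: "dot I (\<lambda>i. a * z i) x = a * dot I z x"
  by (simp add: dot_def sum_distrib_left algebra_simps)

lemma dot_scale_right: "dot I x (\<lambda>i. a * z i) = a * dot I x z"
  by (simp add: dot_def sum_distrib_left algebra_simps)

lemmas dot_linear = dot_add_scale_right dot_diff_scale_right dot_add_scale_left
  dot_diff_scale_left dot_scale_left dot_scale_right

lemma dot_self_nonneg: "0 \<le> dot I x x"
  by (simp add: dot_def sum_nonneg)

definition orthonormal :: "'i set \<Rightarrow> ('i \<Rightarrow> real) set \<Rightarrow> bool" where
  "orthonormal I E \<longleftrightarrow> (\<forall>e\<in>E. \<forall>f\<in>E. dot I e f = (if e = f then 1 else 0))"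

text \<open>Bessel's inequality for a standard unit vector gives \<open>(\<Sum>e\<in>E. (e i)\<^sup>2) \<le> 1\<close>;
  sum this over \<open>i\<close>.\<close>

lemma orthonormal_card_le:
  assumes "finite I" "finite E" "orthonormal I E"
  shows "card E \<le> card I"
proof -
  have bessel: "(\<Sum>e\<in>E. e i * e i) \<le> 1" if i: "i \<in> I" for i
  proof -
    define u where "u = (\<lambda>l. if l = i then 1 else (0::real))"
    \<comment> \<open>As \<open>dot I u e = e i\<close>, this \<open>p\<close> is the orthogonal
      projection of \<open>u\<close> onto the span of \<open>E\<close>.\<close>
    define p where "p = (\<lambda>l. \<Sum>e\<in>E. e i * e l)"
    have up: "dot I u p = (\<Sum>e\<in>E. e i * e i)" and uu: "dot I u u = 1"
      using i \<open>finite I\<close>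
      by (simp_all add: dot_def u_def p_def if_distrib[of "\<lambda>x. x * _"] cong: if_cong)
    have fp: "dot I f p = f i" if "f \<in> E" for f
    proof -
      have "dot I f p = (\<Sum>l\<in>I. \<Sum>e\<in>E. e i * (f l * e l))"
        by (simp add: dot_def p_def sum_distrib_left algebra_simps)
      also have "\<dots> = (\<Sum>e\<in>E. e i * dot I f e)"
        by (subst sum.swap) (simp add: dot_def sum_distrib_left)
      also have "\<dots> = (\<Sum>e\<in>E. if e = f then e i else 0)"
        using that assms(3) by (intro sum.cong) (auto simp: orthonormal_def)
      also have "\<dots> = f i"
        using that \<open>finite E\<close> by simp
      finally show ?thesis .
    qed
    have "dot I p p = (\<Sum>l\<in>I. \<Sum>e\<in>E. e i * (e l * p l))"
      by (simp add: dot_def p_def[abs_def] sum_distrib_right mult.assoc)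
    also have "\<dots> = (\<Sum>e\<in>E. e i * dot I e p)"
      by (subst sum.swap) (simp add: dot_def sum_distrib_left)
    also have "\<dots> = (\<Sum>e\<in>E. e i * e i)"
      by (simp add: fp)
    finally have pp: "dot I p p = (\<Sum>e\<in>E. e i * e i)" .
    \<comment> \<open>With \<open>S\<close> the sum to be bounded, \<open>u - p\<close> has squared
      length \<open>1 - 2 * S + S\<close>. The coefficient \<open>1\<close> gives the difference the
      shape that \<open>dot_linear\<close> rewrites.\<close>
    have "0 \<le> dot I (\<lambda>l. u l - 1 * p l) (\<lambda>l. u l - 1 * p l)"
      by (rule dot_self_nonneg)
    also have "\<dots> = 1 - (\<Sum>e\<in>E. e i * e i)"
      unfolding dot_linear using up uu pp dot_commute[of I u p] by simp
    finally show ?thesis by simp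
  qed
  have "real (card E) = (\<Sum>e\<in>E. dot I e e)"
    using assms(3) by (simp add: orthonormal_def)
  also have "\<dots> = (\<Sum>i\<in>I. \<Sum>e\<in>E. e i * e i)"
    unfolding dot_def by (rule sum.swap)
  also have "\<dots> \<le> real (card I)"
    using sum_bounded_above[of I "\<lambda>i. \<Sum>e\<in>E. e i * e i" 1] bessel by simp
  finally show ?thesis by simp
qed

lemma orthonormal_insert_normalized:
  assumes "orthonormal I E" "\<And>e. e \<in> E \<Longrightarrow> dot I e x = 0" "0 < dot I x x"
  defines "f \<equiv> \<lambda>i. 1 / sqrt (dot I x x) * x i"
  shows "orthonormal I (insert f E)" "f \<notin> E"
proof -
  have "dot I f f = 1"
    using assms(3) unfolding f_def dot_linear by (simp add: field_simps)
  moreover have ef: "dot I e f = 0" "dot I f e = 0" if "e \<in> E" for e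
    using assms(2)[OF that] dot_commute[of I e x] unfolding f_def dot_linear by simp_all
  ultimately show "orthonormal I (insert f E)" "f \<notin> E"
    using assms(1) by (auto simp: orthonormal_def)
qed

section \<open>Successive projection of the lattice\<close>

text \<open>A positive infimum is smaller than twice itself, so some value lies below its double.
  Allowing the factor \<open>2\<close> asks only for the lower bound \<open>c\<close>, not for an
  attained minimum.\<close>

lemma exists_near_minimum:
  fixes q :: "'a \<Rightarrow> real"
  assumes "0 < c" "\<And>m. q m \<noteq> 0 \<Longrightarrow> c \<le> q m" "q m1 \<noteq> 0"
  obtains m0 where "q m0 \<noteq> 0" "\<And>m. q m \<noteq> 0 \<Longrightarrow> q m0 \<le> 2 * q m"
proof -
  define S where "S = q ` {m. q m \<noteq> 0}"
  have ne: "S \<noteq> {}" and bdd: "bdd_below S" and "c \<le> Inf S"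
    using assms by (auto simp: S_def intro!: bdd_belowI[of _ c] cINF_greatest)
  then have "Inf S < 2 * Inf S" using \<open>0 < c\<close> by simp
  then obtain x where "x \<in> S" "x < 2 * Inf S"
    using cInf_lessD[OF ne] by blast
  then obtain m0 where m0: "q m0 \<noteq> 0" "q m0 < 2 * Inf S" by (auto simp: S_def)
  have "q m0 \<le> 2 * q m" if "q m \<noteq> 0" for m
    using cInf_lower[OF _ bdd, of "q m"] that m0(2) by (auto simp: S_def)
  with m0(1) show thesis by (rule that)
qed

text \<open>Orthogonal projection along a lattice vector \<open>V m0\<close> whose length is minimal up to a
  factor \<open>sqrt 2\<close> lowers the minimum of the squared length by at most a factor \<open>2\<close>, because
  every projected vector lifts to one whose component along \<open>V m0\<close> is at most half of \<open>V m0\<close>.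
  The set \<open>E\<close> records the directions that were already projected away.\<close>

lemma kronecker_homogeneous_to_inhomogeneous:
  fixes V :: "('j \<Rightarrow> int) \<Rightarrow> 'i \<Rightarrow> real" and \<phi> :: "('j \<Rightarrow> int) \<Rightarrow> real"
  assumes "finite I" "finite E" "orthonormal I E" "card I = card E + d" "0 < c"
    and "\<And>m m' r i. V (\<lambda>j. m j - r * m' j) i = V m i - of_int r * V m' i"
    and "\<And>m m' r. \<phi> (\<lambda>j. m j - r * m' j) = \<phi> m - of_int r * \<phi> m'"
    and "\<And>m e. e \<in> E \<Longrightarrow> dot I e (V m) = 0"
    and "\<And>m. dot I (V m) (V m) \<noteq> 0 \<Longrightarrow> c \<le> dot I (V m) (V m)"
    and "\<And>m. dot I (V m) (V m) = 0 \<Longrightarrow> \<phi> m \<in> \<int>"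
  shows "\<exists>s. dot I s s \<le> (2 ^ d - 1) / (4 * c) \<and> (\<forall>e\<in>E. dot I e s = 0) \<and>
             (\<forall>m. dot I s (V m) - \<phi> m \<in> \<int>)"
  using assms(2-)
proof (induction d arbitrary: E V \<phi> c)
  case (0 E V \<phi> c)
  have "dot I (V m) (V m) = 0" for m
  \<comment> \<open>Here \<open>E\<close> already has \<open>card I\<close> elements, and a vector
    of positive length orthogonal to it would give one more.\<close>
  proof (rule ccontr)
    assume "dot I (V m) (V m) \<noteq> 0"
    then have pos: "0 < dot I (V m) (V m)" using dot_self_nonneg[of I "V m"] by simp
    define e where "e = (\<lambda>i. 1 / sqrt (dot I (V m) (V m)) * V m i)"
    have "orthonormal I (insert e E)" "e \<notin> E"
      unfolding e_def using orthonormal_insert_normalized[OF "0.prems"(2,7) pos] by auto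
    then show False
      using orthonormal_card_le[of I "insert e E"] "0.prems"(1,3) \<open>finite I\<close> by simp
  qed
  then have "\<phi> m \<in> \<int>" for m using "0.prems" by blast
  then show ?case
    by (intro exI[of _ "\<lambda>_. 0"]) (simp add: dot_def)
next
  case (Suc d E V \<phi> c)
  show ?case
  proof (cases "\<forall>m. dot I (V m) (V m) = 0")
    case True
    then have "\<phi> m \<in> \<int>" for m using Suc.prems by blast
    moreover have "(0::real) \<le> 2 ^ Suc d - 1"
      by (simp only: diff_ge_0_iff_ge one_le_power)
    ultimately show ?thesis
      using \<open>0 < c\<close> by (intro exI[of _ "\<lambda>_. 0"]) (simp add: dot_def)
  next
    case False
    then obtain m0 where m0: "dot I (V m0) (V m0) \<noteq> 0"
      and m0_min: "\<And>m. dot I (V m) (V m) \<noteq> 0 \<Longrightarrow> dot I (V m0) (V m0) \<le> 2 * dot I (V m) (V m)"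
      using exists_near_minimum[of c "\<lambda>m. dot I (V m) (V m)"] Suc.prems(4,8) by blast
    define l where "l = sqrt (dot I (V m0) (V m0))"
    have pos: "0 < dot I (V m0) (V m0)"
      using m0 dot_self_nonneg[of I "V m0"] by simp
    then have l: "0 < l" "dot I (V m0) (V m0) = l\<^sup>2" by (simp_all add: l_def)
    define e where "e = (\<lambda>i. 1 / l * V m0 i)"
    have e: "orthonormal I (insert e E)" "e \<notin> E"
      unfolding e_def l_def using orthonormal_insert_normalized[OF Suc.prems(2,7) pos] by auto
    then have ee: "dot I e e = 1" and eE: "\<And>f. f \<in> E \<Longrightarrow> dot I f e = 0"
      by (auto simp: orthonormal_def)
    have e0: "dot I e (V m0) = l"
      using l unfolding e_def dot_linear by (simp add: power2_eq_square)
    have V_diff: "V (\<lambda>j. m j - r * m' j) = (\<lambda>i. V m i - of_int r * V m' i)" for m r m'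
      using Suc.prems(5) by blast
    \<comment> \<open>The smallest coefficient along \<open>e\<close> for which
      \<open>\<kappa> * l\<close> agrees with \<open>\<phi> m0\<close> modulo 1. In
      \<open>\<phi>'\<close> the contribution of \<open>\<kappa> * e\<close> is subtracted
      beforehand, so that the induction hypothesis handles only what remains.\<close>
    define \<kappa> where "\<kappa> = (\<phi> m0 - of_int (round (\<phi> m0))) / l"
    define V' where "V' m i = V m i - dot I e (V m) * e i" for m i
    define \<phi>' where "\<phi>' m = \<phi> m - \<kappa> * dot I e (V m)" for m
    have V'_eq: "V' m = (\<lambda>i. V m i - dot I e (V m) * e i)" for m
      by (simp add: V'_def fun_eq_iff)
    have eV': "dot I e (V' m) = 0" for m
      unfolding V'_eq dot_linear using ee by simp
    have V'V': "dot I (V' m) (V' m) = dot I (V m) (V m) - (dot I e (V m))\<^sup>2" for m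
      unfolding V'_eq dot_linear using ee dot_commute[of I "V m" e]
      by (simp add: power2_eq_square)
    \<comment> \<open>Subtracting multiples of \<open>V m0\<close> leaves the projection unchanged;
      rounding brings the component along \<open>e\<close> down to at most
      \<open>l / 2\<close>.\<close>
    have reduce: "\<exists>r. dot I (V (\<lambda>j. m j - r * m0 j)) (V (\<lambda>j. m j - r * m0 j)) =
        dot I (V' m) (V' m) + (dot I e (V m) - of_int r * l)\<^sup>2 \<and>
        (dot I e (V m) - of_int r * l)\<^sup>2 \<le> l\<^sup>2 / 4" for m
    proof (intro exI conjI)
      let ?a = "dot I e (V m)"
      let ?r = "round (?a / l)"
      have "V m0 = (\<lambda>i. l * e i)" using l by (simp add: e_def)
      then have "dot I (V m) (V m0) = l * ?a"
        using dot_commute[of I "V m" e] by (simp add: dot_linear)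
      then show "dot I (V (\<lambda>j. m j - ?r * m0 j)) (V (\<lambda>j. m j - ?r * m0 j)) =
          dot I (V' m) (V' m) + (?a - of_int ?r * l)\<^sup>2"
        unfolding V_diff V'V' dot_linear using l(2) dot_commute[of I "V m" "V m0"]
        by (simp add: power2_eq_square algebra_simps)
      have "?a - of_int ?r * l = (?a / l - of_int ?r) * l"
        using l(1) by (simp add: field_simps)
      then have "\<bar>?a - of_int ?r * l\<bar> \<le> 1 / 2 * l"
        using l(1) of_int_round_abs_le[of "?a / l"]
        by (simp only: abs_mult) (intro mult_mono, auto simp: abs_minus_commute)
      then have "(?a - of_int ?r * l)\<^sup>2 \<le> (1 / 2 * l)\<^sup>2"
        by (metis abs_ge_zero power2_abs power_mono)
      then show "(?a - of_int ?r * l)\<^sup>2 \<le> l\<^sup>2 / 4"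
        by (simp add: power2_eq_square)
    qed
    have \<kappa>l: "\<phi> m0 - \<kappa> * l \<in> \<int>" using l by (simp add: \<kappa>_def)
    have "\<exists>s. dot I s s \<le> (2 ^ d - 1) / (4 * (c / 2)) \<and> (\<forall>f\<in>insert e E. dot I f s = 0) \<and>
             (\<forall>m. dot I s (V' m) - \<phi>' m \<in> \<int>)"
    proof (rule Suc.IH)
      show "V' (\<lambda>j. m j - r * m' j) i = V' m i - of_int r * V' m' i" for m m' r i
        unfolding V'_def V_diff dot_linear by (simp add: algebra_simps)
      show "\<phi>' (\<lambda>j. m j - r * m' j) = \<phi>' m - of_int r * \<phi>' m'" for m m' r
        unfolding \<phi>'_def V_diff dot_linear Suc.prems(6) by (simp add: algebra_simps)
      show "dot I f (V' m) = 0" if "f \<in> insert e E" for m f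
        using that eV' eE Suc.prems(7) unfolding V'_eq dot_linear by auto
      \<comment> \<open>Let \<open>w\<close> be the squared length of the lift. Near minimality
        gives \<open>l\<^sup>2 / 4 \<le> w / 2\<close>, so the projection keeps at least
        \<open>w / 2 \<ge> c / 2\<close>.\<close>
      show "c / 2 \<le> dot I (V' m) (V' m)" if nz: "dot I (V' m) (V' m) \<noteq> 0" for m
      proof -
        obtain r where r: "dot I (V (\<lambda>j. m j - r * m0 j)) (V (\<lambda>j. m j - r * m0 j)) =
              dot I (V' m) (V' m) + (dot I e (V m) - of_int r * l)\<^sup>2"
            "(dot I e (V m) - of_int r * l)\<^sup>2 \<le> l\<^sup>2 / 4"
          using reduce by blast
        have "dot I (V (\<lambda>j. m j - r * m0 j)) (V (\<lambda>j. m j - r * m0 j)) \<noteq> 0"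
          using r(1) nz dot_self_nonneg[of I "V' m"] by (simp add: add_nonneg_eq_0_iff)
        from m0_min[OF this] Suc.prems(8)[OF this] r l(2) show ?thesis by linarith
      qed
      \<comment> \<open>A lift of a vanishing projection has squared length at most
        \<open>l\<^sup>2 / 4\<close>, less than near minimality allows for a nonzero vector. So it
        is zero, and \<open>\<phi>' m\<close> is an integer because
        \<open>\<phi> m0 - \<kappa> * l\<close> is one.\<close>
      show "\<phi>' m \<in> \<int>" if z: "dot I (V' m) (V' m) = 0" for m
      proof -
        obtain r where r: "dot I (V (\<lambda>j. m j - r * m0 j)) (V (\<lambda>j. m j - r * m0 j)) =
              (dot I e (V m) - of_int r * l)\<^sup>2"
            "(dot I e (V m) - of_int r * l)\<^sup>2 \<le> l\<^sup>2 / 4"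
          using reduce z by force
        have "dot I (V (\<lambda>j. m j - r * m0 j)) (V (\<lambda>j. m j - r * m0 j)) = 0"
        proof (rule ccontr)
          assume "\<not> ?thesis"
          from m0_min[OF this] r l pos show False by linarith
        qed
        then have "dot I e (V m) = of_int r * l" "\<phi> m - of_int r * \<phi> m0 \<in> \<int>"
          using r Suc.prems(6,9) by (simp, metis)
        then have "\<phi>' m = (\<phi> m - of_int r * \<phi> m0) + of_int r * (\<phi> m0 - \<kappa> * l)"
          by (simp add: \<phi>'_def algebra_simps)
        also have "\<dots> \<in> \<int>" using \<kappa>l \<open>\<phi> m - of_int r * \<phi> m0 \<in> \<int>\<close> by (intro Ints_add Ints_mult) auto
        finally show ?thesis .
      qed
    qed (use Suc.prems e in auto)
    then obtain s where s: "dot I s s \<le> (2 ^ d - 1) / (4 * (c / 2))"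
      "\<And>f. f \<in> insert e E \<Longrightarrow> dot I f s = 0" "\<And>m. dot I s (V' m) - \<phi>' m \<in> \<int>"
      by blast
    have es: "dot I e s = 0" "dot I s e = 0" using s(2) dot_commute[of I s e] by auto
    have "\<bar>\<kappa>\<bar> \<le> 1 / 2 / l"
      using l(1) of_int_round_abs_le[of "\<phi> m0"]
      unfolding \<kappa>_def abs_divide by (intro frac_le) (auto simp: abs_minus_commute)
    then have "\<kappa>\<^sup>2 \<le> (1 / 2 / l)\<^sup>2"
      by (metis abs_ge_zero power2_abs power_mono)
    also have "\<dots> = 1 / (4 * l\<^sup>2)" by (simp add: power2_eq_square)
    also have "\<dots> \<le> 1 / (4 * c)"
      using Suc.prems(4) Suc.prems(8)[OF m0] l(2) by (intro frac_le) auto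
    finally have \<kappa>: "\<kappa>\<^sup>2 \<le> 1 / (4 * c)" .
    \<comment> \<open>The correction is orthogonal to \<open>s\<close>, so squared lengths add up;
      its product with \<open>V m\<close> restores the term subtracted in
      \<open>\<phi>'\<close>.\<close>
    let ?s = "\<lambda>i. s i + \<kappa> * e i"
    have "dot I ?s ?s = dot I s s + \<kappa>\<^sup>2"
      unfolding dot_linear using es ee by (simp add: power2_eq_square)
    also have "\<dots> \<le> (2 ^ d - 1) / (4 * (c / 2)) + 1 / (4 * c)"
      using s(1) \<kappa> by (rule add_mono)
    also have "\<dots> = (2 ^ Suc d - 1) / (4 * c)"
      using \<open>0 < c\<close> by (simp add: field_simps)
    finally have "dot I ?s ?s \<le> (2 ^ Suc d - 1) / (4 * c)" .
    moreover have "dot I f ?s = 0" if "f \<in> E" for f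
      unfolding dot_linear using that s(2) eE by simp
    moreover have "dot I ?s (V m) - \<phi> m \<in> \<int>" for m
      using s(3)[of m] es unfolding \<phi>'_def V'_eq dot_linear by (simp add: algebra_simps)
    ultimately show ?thesis by blast
  qed
qed

section \<open>Size of the constant \<open>\<gamma>\<close>\<close>

lemma fact_ge_power_two: "1 \<le> N \<Longrightarrow> 2 ^ (N - 1) \<le> (fact N :: real)"
proof (induction N rule: dec_induct)
  case (step n)
  then have "2 * 2 ^ (n - 1) \<le> real (Suc n) * (fact n :: real)"
    by (intro mult_mono) auto
  with step show ?case by (cases n) auto
qed simp

text \<open>The second bound makes \<open>(2 ^ Suc N - 1) / (4 * c)\<close> at most 1 when
  \<open>c = (1 / (2 * \<gamma>))\<^sup>2\<close>. It follows from
  \<open>\<gamma> * 2 ^ N \<le> 1\<close>, a consequence of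
  \<open>2 ^ (N - 1) \<le> fact N\<close>.\<close>

lemma kron_gamma_bounds:
  assumes "1 \<le> N"
  shows "0 < kron_gamma N" "(kron_gamma N)\<^sup>2 * 2 ^ Suc N \<le> 1"
proof -
  show pos: "0 < kron_gamma N"
    using assms by (simp add: kron_gamma_def)
  have "2 powi (int N - 2) = (2::real) ^ N / 4"
    by (simp add: power_int_diff)
  then have g: "kron_gamma N = 2 ^ N / (4 * (real N * (fact N)\<^sup>2))"
    by (simp only: kron_gamma_def divide_divide_eq_left)
  have "2 ^ N * (2::real) ^ N = 4 * (2 ^ (N - 1))\<^sup>2"
    using assms by (cases N) (auto simp: power2_eq_square)
  also have "\<dots> \<le> 4 * (fact N)\<^sup>2"
    using fact_ge_power_two[OF assms] by (intro mult_left_mono power_mono) auto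
  also have "\<dots> \<le> 4 * (real N * (fact N)\<^sup>2)"
    using assms by simp
  finally have "kron_gamma N * 2 ^ N \<le> 1"
    using assms by (simp add: g)
  then have "(kron_gamma N * 2 ^ N)\<^sup>2 \<le> 1"
    using pos by (intro power_le_one) auto
  moreover have "(2::real) ^ Suc N \<le> (2 ^ N)\<^sup>2"
    using assms power_increasing[of "Suc N" "N * 2" "2::real"] by (simp add: power_mult)
  then have "(kron_gamma N)\<^sup>2 * 2 ^ Suc N \<le> (kron_gamma N)\<^sup>2 * (2 ^ N)\<^sup>2"
    by (intro mult_left_mono) auto
  ultimately show "(kron_gamma N)\<^sup>2 * 2 ^ Suc N \<le> 1"
    by (simp add: power_mult_distrib)
qed

section \<open>Application to the lattice in \<open>N + 1\<close> dimensions\<close>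

theorem theorem1:
  fixes N :: nat and \<delta> \<gamma> T :: real and \<epsilon> M lam :: "nat \<Rightarrow> real"
  assumes "N \<ge> 1" and "\<delta> > 0"
    and "\<gamma> = kron_gamma N"
    and "T = 1 / (\<gamma> * \<delta>)"
    and "\<And>j. j \<in> {1..N} \<Longrightarrow> 0 < \<epsilon> j \<and> \<epsilon> j < 1 / 2"
    and "\<And>j. j \<in> {1..N} \<Longrightarrow> M j = 1 / (\<gamma> * \<epsilon> j)"
    and "Min ((\<lambda>m. \<bar>\<Sum>j=1..N. real_of_int (m j) * lam j\<bar>) ` coeff_vectors N M) \<ge> \<delta>"
  shows "\<forall>(\<alpha> :: nat \<Rightarrow> real) (\<tau> :: real). \<exists>t\<in>{\<tau>..\<tau> + T}. \<forall>j\<in>{1..N}.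
           dist_nearest_int (lam j * t - \<alpha> j) \<le> \<epsilon> j"
proof (intro allI)
  fix \<alpha> :: "nat \<Rightarrow> real" and \<tau> :: real
  have \<gamma>: "0 < \<gamma>" and \<gamma>_le: "\<gamma>\<^sup>2 * 2 ^ Suc N \<le> 1"
    using kron_gamma_bounds assms(1,3) by auto
  have T: "0 < T" using \<gamma> assms(2,4) by simp
  \<comment> \<open>Targets are measured from the midpoint of the interval, so that the admissible
    shifts are those of size at most \<open>T / 2\<close>.\<close>
  define \<theta> where "\<theta> j = \<alpha> j - lam j * (\<tau> + T / 2)" for j
  define L where "L m = (\<Sum>j=1..N. real_of_int (m j) * lam j)" for m
  define V where "V m i = (if i = 0 then T / 2 * L m else \<epsilon> i * of_int (m i))" for m i
  define \<phi> where "\<phi> m = (\<Sum>j=1..N. real_of_int (m j) * \<theta> j)" for m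
  define c where "c = (1 / (2 * \<gamma>))\<^sup>2"
  have c: "0 < c" using \<gamma> by (simp add: c_def)
  have L_diff: "L (\<lambda>j. m j - r * m' j) = L m - of_int r * L m'" for m r m'
    by (simp add: L_def sum_subtractf sum_distrib_left algebra_simps)
  have large: "c \<le> dot {0..N} (V m) (V m)" if j: "j \<in> {1..N}" "m j \<noteq> 0" for m j
  proof -
    have V_le: "c \<le> dot {0..N} (V m) (V m)" if "i \<in> {0..N}" "1 / (2 * \<gamma>) \<le> \<bar>V m i\<bar>" for i
    proof -
      have "c \<le> \<bar>V m i\<bar>\<^sup>2" unfolding c_def using that \<gamma> by (intro power_mono) auto
      also have "\<dots> = V m i * V m i" by (simp add: power2_eq_square)
      also have "\<dots> \<le> dot {0..N} (V m) (V m)"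
        unfolding dot_def using that by (intro member_le_sum) auto
      finally show ?thesis .
    qed
    show ?thesis
    \<comment> \<open>Inside the box the hypothesis makes coordinate \<open>0\<close> at least
      \<open>T / 2 * \<delta> = 1 / (2 * \<gamma>)\<close>; outside it some coordinate
      \<open>i\<close> exceeds \<open>\<epsilon> i * M i = 1 / \<gamma>\<close>.\<close>
    proof (cases "\<forall>i\<in>{1..N}. \<bar>real_of_int (m i)\<bar> \<le> M i")
      case True
      \<comment> \<open>Members of \<open>coeff_vectors\<close> are extensional, whereas
        \<open>m\<close> is arbitrary outside \<open>{1..N}\<close>.\<close>
      then have "restrict m {1..N} \<in> coeff_vectors N M"
        using j by (auto simp: coeff_vectors_def)
      then have "\<delta> \<le> \<bar>\<Sum>j=1..N. real_of_int (restrict m {1..N} j) * lam j\<bar>"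
        using assms(7) Min_le[OF finite_imageI[OF finite_coeff_vectors]] by (meson imageI order_trans)
      also have "\<dots> = \<bar>L m\<bar>" by (simp add: L_def)
      finally have "T / 2 * \<delta> \<le> T / 2 * \<bar>L m\<bar>"
        using T by (intro mult_left_mono) auto
      moreover have "T / 2 * \<delta> = 1 / (2 * \<gamma>)"
        using assms(2,4) by simp
      ultimately have "1 / (2 * \<gamma>) \<le> T / 2 * \<bar>L m\<bar>" by linarith
      also have "\<dots> = \<bar>V m 0\<bar>" using T by (simp add: V_def abs_mult)
      finally have "1 / (2 * \<gamma>) \<le> \<bar>V m 0\<bar>" .
      then show ?thesis by (intro V_le[of 0]) auto
    next
      case False
      then obtain i where i: "i \<in> {1..N}" "M i < \<bar>real_of_int (m i)\<bar>" by force
      then have \<epsilon>: "0 < \<epsilon> i" using assms(5) by blast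
      have "1 / (2 * \<gamma>) \<le> 1 / \<gamma>" using \<gamma> by (simp add: field_simps)
      also have "\<dots> = \<epsilon> i * M i" using \<epsilon> assms(6)[OF i(1)] by simp
      also have "\<dots> \<le> \<epsilon> i * \<bar>real_of_int (m i)\<bar>" using \<epsilon> i by simp
      also have "\<dots> = \<bar>V m i\<bar>" using \<epsilon> i by (simp add: V_def abs_mult)
      finally show ?thesis using i by (intro V_le[of i]) auto
    qed
  qed
  \<comment> \<open>No direction has been projected away yet: \<open>E\<close> is empty and
    \<open>d = N + 1\<close>, the number of coordinates.\<close>
  have "\<exists>s. dot {0..N} s s \<le> (2 ^ Suc N - 1) / (4 * c) \<and> (\<forall>e\<in>{}. dot {0..N} e s = 0) \<and>
            (\<forall>m. dot {0..N} s (V m) - \<phi> m \<in> \<int>)"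
  proof (rule kronecker_homogeneous_to_inhomogeneous)
    show "\<phi> m \<in> \<int>" if "dot {0..N} (V m) (V m) = 0" for m
    proof -
      have "\<forall>j\<in>{1..N}. m j = 0" using large[of _ m] c that by fastforce
      then show ?thesis by (simp add: \<phi>_def)
    qed
    show "c \<le> dot {0..N} (V m) (V m)" if "dot {0..N} (V m) (V m) \<noteq> 0" for m
    proof (rule ccontr)
      assume "\<not> ?thesis"
      then have "\<forall>j\<in>{1..N}. m j = 0" using large[of _ m] by blast
      then have "V m i = 0" if "i \<in> {0..N}" for i using that by (simp add: V_def L_def)
      then have "dot {0..N} (V m) (V m) = 0" by (simp add: dot_def)
      with that show False by simp
    qed
  qed (use c in \<open>auto simp: orthonormal_def V_def L_diff \<phi>_def sum_subtractf sum_distrib_left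
         algebra_simps\<close>)
  then obtain s where s: "dot {0..N} s s \<le> (2 ^ Suc N - 1) / (4 * c)"
    and s_int: "\<And>m. dot {0..N} s (V m) - \<phi> m \<in> \<int>" by blast
  have "(2 ^ Suc N - 1) / (4 * c) = \<gamma>\<^sup>2 * 2 ^ Suc N - \<gamma>\<^sup>2"
    using \<gamma> by (simp add: c_def power2_eq_square field_simps)
  also have "\<dots> \<le> 1" using \<gamma>_le \<gamma> zero_le_power2[of \<gamma>] by linarith
  finally have "dot {0..N} s s \<le> 1" using s by linarith
  then have "(s i)\<^sup>2 \<le> 1" if "i \<in> {0..N}" for i
    using that member_le_sum[of i "{0..N}" "\<lambda>i. s i * s i"]
    by (simp add: dot_def power2_eq_square)
  then have s_le: "\<bar>s i\<bar> \<le> 1" if "i \<in> {0..N}" for i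
    using that by (simp add: abs_square_le_1)
  define t where "t = \<tau> + T / 2 + T / 2 * s 0"
  have "\<bar>T / 2 * s 0\<bar> \<le> T / 2"
    using s_le[of 0] T mult_left_mono[of "\<bar>s 0\<bar>" 1 "T / 2"] by (simp add: abs_mult)
  then have "\<tau> \<le> t" "t \<le> \<tau> + T"
    unfolding t_def by linarith+
  moreover have "dist_nearest_int (lam j * t - \<alpha> j) \<le> \<epsilon> j" if j: "j \<in> {1..N}" for j
  proof -
    \<comment> \<open>Testing \<open>s\<close> on the \<open>j\<close>-th unit vector isolates the
      \<open>j\<close>-th congruence: \<open>lam j * t - \<alpha> j\<close> differs from an integer
      by \<open>s j * \<epsilon> j\<close>.\<close>
    define u where "u i = (if i = j then 1 else (0::int))" for i
    have Lu: "L u = lam j" and \<phi>u: "\<phi> u = \<theta> j"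
      using j by (simp_all add: L_def \<phi>_def u_def if_distrib[of real_of_int] if_distrib[of "\<lambda>x. x * _"]
          cong: if_cong)
    have "dot {0..N} s (V u) = s 0 * V u 0 + (\<Sum>i=1..N. s i * V u i)"
      by (simp add: dot_def sum.atLeast_Suc_atMost)
    also have "(\<Sum>i=1..N. s i * V u i) = (\<Sum>i=1..N. if i = j then s j * \<epsilon> j else 0)"
      by (intro sum.cong) (auto simp: V_def u_def)
    also have "\<dots> = s j * \<epsilon> j" using j by simp
    also have "V u 0 = T / 2 * lam j" by (simp add: V_def Lu)
    finally have "dot {0..N} s (V u) - \<phi> u = lam j * t - \<alpha> j + s j * \<epsilon> j"
      by (simp add: \<phi>u \<theta>_def t_def algebra_simps)
    with s_int[of u] obtain k where "lam j * t - \<alpha> j + s j * \<epsilon> j = of_int k"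
      by (auto elim: Ints_cases)
    then have "\<bar>lam j * t - \<alpha> j - of_int k\<bar> = \<bar>s j\<bar> * \<bar>\<epsilon> j\<bar>"
      by (simp flip: abs_mult)
    also have "\<dots> \<le> 1 * \<epsilon> j"
      using assms(5)[OF j] s_le[of j] j by (intro mult_mono) auto
    finally show ?thesis using dist_nearest_int_le[of "lam j * t - \<alpha> j" k] by simp
  qed
  ultimately show "\<exists>t\<in>{\<tau>..\<tau> + T}. \<forall>j\<in>{1..N}. dist_nearest_int (lam j * t - \<alpha> j) \<le> \<epsilon> j"
    by (intro bexI[of _ t]) auto
qed

end
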